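(* In the channel setting of the context, suppose the channel is monotonic, i.e. $\|F_{\mathrm{push}}\|\le1$. Then $$\operatorname{Bnd}_{\mathrm{out}}\ge\operatorname{Bnd},\qquad\|\operatorname{Imap}\|\le1 ,$$ where $\operatorname{Imap}=F^{\mathrm{pull}}F_{\mathrm{push}}:\mathcal T(f)\to\mathcal T(f)$ is the information map and norms of maps are operator norms.
   Context: Input. $\mathcal T_\theta$ is a real vector space (tangent vectors $\dot\phi$ at a fixed parameter $\theta$) and $d\beta:\mathcal T_\theta\to\mathbb R$ a linear functional. $\mathcal V$ is a real vector space with semi-inner product $\langle\cdot,\cdot\rangle_f$ and seminorm $\|\cdot\|_f$; $\operatorname{score}:\mathcal T_\theta\to\mathcal V$ is linear; $\mathcal N(f)=\{A\in\mathcal V:\|A\|_f=0\}$; $\mathcal A(f)$ is the Hilbert-space completion of $\mathcal V/\mathcal N(f)$; $f_{\mathrm{push}}:\mathcal T_\theta\to\mathcal A(f)$, $f_{\mathrm{push}}\dot\phi=\operatorname{score}(\dot\phi)+\mathcal N(f)$; $\mathcal T(f)=\overline{\operatorname{range}f_{\mathrm{push}}}\subseteq\mathcal A(f)$. Output. Similarly $\mathcal V_{\mathrm{out}}$, $\langle\cdot,\cdot\rangle_g$, $\operatorname{score}_{\mathrm{out}}:\mathcal T_\theta\to\mathcal V_{\mathrm{out}}$, $\mathcal N(g)$, $\mathcal A(g)$, $g_{\mathrm{push}}:\mathcal T_\theta\to\mathcal A(g)$, $\mathcal T(g)=\overline{\operatorname{range}g_{\mathrm{push}}}$ are defined in the same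 way for the output. Efficiency bounds. $\operatorname{Bnd}=\sup_{\dot\phi:\,f_{\mathrm{push}}\dot\phi\ne0}[d\beta(\dot\phi)]^2/\|f_{\mathrm{push}}\dot\phi\|_f^2\in[0,\infty]$ (with $\sup\emptyset=0$) if $d\beta$ vanishes on $\ker f_{\mathrm{push}}$, and $\operatorname{Bnd}=\infty$ otherwise. $\operatorname{Bnd}_{\mathrm{out}}$ is defined in the same way with $g_{\mathrm{push}}$, $\|\cdot\|_g$ in place of $f_{\mathrm{push}}$, $\|\cdot\|_f$. Channel. There is a bounded linear map $F_{\mathrm{push}}:\operatorname{range}f_{\mathrm{push}}\to\mathcal A(g)$ with $g_{\mathrm{push}}=F_{\mathrm{push}}f_{\mathrm{push}}$, extended uniquely by continuity to a bounded map $F_{\mathrm{push}}:\mathcal T(f)\to\mathcal A(g)$ (the channel pushforward). Its Hilbert-space adjoint is the channel pullback $F^{\mathrm{pull}}=F_{\mathrm{push}}^\dagger:\mathcal A(g)\to\mathcal T(f)$. *)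

theory Defs
  imports "HOL-Analysis.Analysis"
begin

definition semi_inner_product :: "('v::real_vector \<Rightarrow> 'v \<Rightarrow> real) \<Rightarrow> bool" where
  "semi_inner_product ip \<longleftrightarrow>
     bilinear ip \<and> (\<forall>A B. ip A B = ip B A) \<and> (\<forall>A. 0 \<le> ip A A)"

definition seminorm :: "('v::real_vector \<Rightarrow> 'v \<Rightarrow> real) \<Rightarrow> 'v \<Rightarrow> real" where
  "seminorm ip A = sqrt (ip A A)"

definition null_vectors :: "('v::real_vector \<Rightarrow> 'v \<Rightarrow> real) \<Rightarrow> 'v set" where
  "null_vectors ip = {A. seminorm ip A = 0}"

definition null_coset :: "('v::real_vector \<Rightarrow> 'v \<Rightarrow> real) \<Rightarrow> 'v \<Rightarrow> 'v set" where
  "null_coset ip A = {A + n |n. n \<in> null_vectors ip}"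

text \<open>
  The completion of the quotient by the null vectors depends on \<open>ip\<close>, so it cannot be a type
  constructed from \<open>'v\<close>. It is given by a Hilbert space \<open>'h\<close> and the embedding of
  the quotient: linear, inner-product preserving and with dense range. This determines \<open>'h\<close>
  up to a unique isometric isomorphism. Only the values of \<open>emb\<close> on cosets matter.
\<close>

definition hilbert_completion ::
  "('v::real_vector \<Rightarrow> 'v \<Rightarrow> real) \<Rightarrow> ('v set \<Rightarrow> 'h::{real_inner,complete_space}) \<Rightarrow> bool" where
  "hilbert_completion ip emb \<longleftrightarrow>
     linear (\<lambda>A. emb (null_coset ip A)) \<and>
     (\<forall>A B. inner (emb (null_coset ip A)) (emb (null_coset ip B)) = ip A B) \<and>
     closure (range (\<lambda>A. emb (null_coset ip A))) = UNIV"

definition push ::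
  "('v::real_vector \<Rightarrow> 'v \<Rightarrow> real) \<Rightarrow> ('v set \<Rightarrow> 'h) \<Rightarrow> ('t \<Rightarrow> 'v) \<Rightarrow> 't \<Rightarrow> 'h" where
  "push ip emb score \<phi> = emb (null_coset ip (score \<phi>))"

definition tangent_space :: "('t \<Rightarrow> 'h::topological_space) \<Rightarrow> 'h set" where
  "tangent_space p = closure (range p)"

text \<open>In \<^typ>\<open>ennreal\<close> the supremum of the empty set is \<open>0\<close>.\<close>

definition Bnd :: "('t \<Rightarrow> real) \<Rightarrow> ('t \<Rightarrow> 'h::real_normed_vector) \<Rightarrow> ennreal" where
  "Bnd d\<beta> p =
     (if \<forall>\<phi>. p \<phi> = 0 \<longrightarrow> d\<beta> \<phi> = 0
      then SUP \<phi>\<in>{\<phi>. p \<phi> \<noteq> 0}. ennreal ((d\<beta> \<phi>)\<^sup>2 / (norm (p \<phi>))\<^sup>2)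
      else \<infinity>)"

text \<open>
  The library's \<^const>\<open>bounded_linear\<close>, \<^const>\<open>onorm\<close> and \<^const>\<open>adjoint\<close> concern maps defined
  on a whole type; the following versions are for maps defined on a subspace \<open>S\<close>.
\<close>

definition bounded_linear_on ::
  "'a::real_normed_vector set \<Rightarrow> ('a \<Rightarrow> 'b::real_normed_vector) \<Rightarrow> bool" where
  "bounded_linear_on S F \<longleftrightarrow>
     (\<forall>x\<in>S. \<forall>y\<in>S. F (x + y) = F x + F y) \<and>
     (\<forall>c. \<forall>x\<in>S. F (c *\<^sub>R x) = c *\<^sub>R F x) \<and>
     (\<exists>K. \<forall>x\<in>S. norm (F x) \<le> norm x * K)"

text \<open>
  With values in \<open>[0,\<infinity>]\<close>, so that the supremum is never an unspecified real number. As in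
  \<^const>\<open>onorm\<close>, the quotient at \<open>x = 0\<close> is \<open>0\<close>.
\<close>

definition onorm_on ::
  "'a::real_normed_vector set \<Rightarrow> ('a \<Rightarrow> 'b::real_normed_vector) \<Rightarrow> ennreal" where
  "onorm_on S F = (SUP x\<in>S. ennreal (norm (F x) / norm x))"

text \<open>Extension by continuity to the closure of \<open>S\<close>; values outside the closure are irrelevant.\<close>

definition extend_by_continuity ::
  "'a::t2_space set \<Rightarrow> ('a \<Rightarrow> 'b::t2_space) \<Rightarrow> 'a \<Rightarrow> 'b" where
  "extend_by_continuity S F x = (if x \<in> S then F x else Lim (at x within S) F)"

definition adjoint_on :: "'a::real_inner set \<Rightarrow> ('a \<Rightarrow> 'b::real_inner) \<Rightarrow> 'b \<Rightarrow> 'a" where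
  "adjoint_on S F y = (THE x. x \<in> S \<and> (\<forall>u\<in>S. inner (F u) y = inner u x))"

end

(* On the tangent space T, the closure of the range of f_push, the extended pushforward F satisfies
   |F x| <= |x|. The adjoint exists by the Riesz theorem, so that <u, Imap x> = <F u, F x> for u in T,
   and u = Imap x gives |Imap x|^2 <= |Imap x| |x|. The bounds compare termwise, because
   |g_push phi| <= |f_push phi|. *)

theory Submission
  imports Defs
begin

section \<open>Bounded linear maps on a subspace and their extension to its closure\<close>

lemma subspace_closure:
  fixes S :: "'a::real_normed_vector set"
  assumes S: "subspace S"
  shows "subspace (closure S)"
  unfolding subspace_def
proof (intro conjI ballI allI)
  show "0 \<in> closure S" using subspace_0[OF S] closure_subset by blast
next
  fix x y assume x: "x \<in> closure S" and y: "y \<in> closure S"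
  obtain s where s: "\<And>n. s n \<in> S" "s \<longlonglongrightarrow> x" using x closure_sequential by metis
  obtain t where t: "\<And>n. t n \<in> S" "t \<longlonglongrightarrow> y" using y closure_sequential by metis
  have "\<And>n. s n + t n \<in> S" using s(1) t(1) S by (simp add: subspace_add)
  then show "x + y \<in> closure S"
    unfolding closure_sequential using tendsto_add[OF s(2) t(2)]
    by (intro exI[of _ "\<lambda>n. s n + t n"]) simp
next
  fix c x assume x: "x \<in> closure S"
  obtain s where s: "\<And>n. s n \<in> S" "s \<longlonglongrightarrow> x" using x closure_sequential by metis
  have "\<And>n. c *\<^sub>R s n \<in> S" using s(1) S by (simp add: subspace_scale)
  then show "c *\<^sub>R x \<in> closure S"
    unfolding closure_sequential using tendsto_scaleR[OF tendsto_const s(2)]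
    by (intro exI[of _ "\<lambda>n. c *\<^sub>R s n"]) simp
qed

text \<open>Enlarging the constant to \<open>max K 1\<close> makes it positive, so that later
  arguments may divide by it.\<close>

lemma bounded_linear_onE:
  assumes "bounded_linear_on S F"
  obtains K where "K > 0" "\<And>x. x \<in> S \<Longrightarrow> norm (F x) \<le> norm x * K"
proof -
  obtain K where K: "\<forall>x\<in>S. norm (F x) \<le> norm x * K"
    using assms by (auto simp: bounded_linear_on_def)
  have "norm (F x) \<le> norm x * max K 1" if "x \<in> S" for x
    using K[rule_format, OF that] mult_left_mono[of K "max K 1" "norm x"] by simp
  with that[of "max K 1"] show ?thesis by simp
qed

lemma bounded_linear_on_diff:
  assumes "bounded_linear_on S F" "subspace S" "x \<in> S" "y \<in> S"
  shows "F (x - y) = F x - F y"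
proof -
  have "F (x + (-1) *\<^sub>R y) = F x + F ((-1) *\<^sub>R y)" "F ((-1) *\<^sub>R y) = (-1) *\<^sub>R F y"
    using assms subspace_scale[OF assms(2,4)] by (simp_all only: bounded_linear_on_def)
  then show ?thesis by simp
qed

text \<open>By linearity the bound applies to differences, so \<open>F\<close> is Lipschitz with
  constant \<open>K\<close>. Continuity has to be uniform for \<open>F\<close> to extend to the
  closure.\<close>

lemma bounded_linear_on_uniformly_continuous:
  assumes F: "bounded_linear_on S F" and S: "subspace S"
  shows "uniformly_continuous_on S F"
proof -
  obtain K where K: "K > 0" "\<And>x. x \<in> S \<Longrightarrow> norm (F x) \<le> norm x * K"
    using bounded_linear_onE[OF F] by metis
  have "dist (F x) (F y) \<le> dist x y * K" if "x \<in> S" "y \<in> S" for x y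
    using K(2)[OF subspace_diff[OF S that]] bounded_linear_on_diff[OF F S that]
    by (simp add: dist_norm)
  then have "dist (F x') (F x) < e" if "x \<in> S" "x' \<in> S" "dist x' x < e / K" for x x' e
    using that K(1) by (meson less_divide_eq order_le_less_trans)
  then show ?thesis
    unfolding uniformly_continuous_on_def using K(1) by (metis divide_pos_pos)
qed

text \<open>Completeness of the codomain gives a uniformly continuous extension \<open>g\<close> of
  \<open>F\<close>. The extension defined through \<open>Lim\<close> is identified with
  \<open>g\<close> on the closure, and additivity, homogeneity and the bound pass to limits of
  sequences from \<open>S\<close>, with the same constant \<open>K\<close>.\<close>

lemma bounded_linear_on_extend_by_continuity:
  fixes F :: "'a::real_normed_vector \<Rightarrow> 'b::{real_normed_vector,complete_space}"
  assumes F: "bounded_linear_on S F" and S: "subspace S"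
  shows "bounded_linear_on (closure S) (extend_by_continuity S F)"
proof -
  obtain K where K: "\<And>x. x \<in> S \<Longrightarrow> norm (F x) \<le> norm x * K"
    using bounded_linear_onE[OF F] by metis
  obtain g where g: "uniformly_continuous_on (closure S) g" and gF: "\<And>x. x \<in> S \<Longrightarrow> F x = g x"
    using uniformly_continuous_on_extension_on_closure[OF bounded_linear_on_uniformly_continuous[OF F S]]
    by metis
  have cont: "continuous_on (closure S) g"
    using g by (rule uniformly_continuous_imp_continuous)
  have ext: "extend_by_continuity S F x = g x" if x: "x \<in> closure S" for x
  proof (cases "x \<in> S")
    case True
    then show ?thesis by (simp add: extend_by_continuity_def gF)
  next
    case False
    \<comment> \<open>A point of the closure outside \<open>S\<close> is a limit point, so the
      filter is nontrivial and \<open>Lim\<close> returns the unique limit instead of an unspecified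
      value.\<close>
    then have "at x within S \<noteq> bot"
      using x by (auto simp: closure_def trivial_limit_within)
    moreover have "(g \<longlongrightarrow> g x) (at x within S)"
      using cont x closure_subset[of S] by (metis continuous_on_def tendsto_within_subset)
    then have "(F \<longlongrightarrow> g x) (at x within S)"
      by (rule Lim_transform_eventually) (auto simp: gF eventually_at_filter)
    ultimately show ?thesis
      using False by (simp add: extend_by_continuity_def tendsto_Lim)
  qed
  have lim: "(\<lambda>n. F (s n)) \<longlonglongrightarrow> g x" if "\<And>n. s n \<in> S" "s \<longlonglongrightarrow> x" for s x
  proof -
    have "x \<in> closure S" using that closure_sequential by blast
    then show ?thesis
      using continuous_on_tendsto_compose[OF cont that(2)] that(1) closure_subset[of S] gF
      by (simp add: subset_iff)
  qed
  show ?thesis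
    unfolding bounded_linear_on_def
  proof (intro conjI exI ballI allI)
    fix x y assume x: "x \<in> closure S" and y: "y \<in> closure S"
    obtain s where s: "\<And>n. s n \<in> S" "s \<longlonglongrightarrow> x" using x closure_sequential by metis
    obtain t where t: "\<And>n. t n \<in> S" "t \<longlonglongrightarrow> y" using y closure_sequential by metis
    have "(\<lambda>n. F (s n + t n)) \<longlonglongrightarrow> g (x + y)"
      using s t S by (intro lim tendsto_intros subspace_add)
    moreover have "(\<lambda>n. F (s n + t n)) \<longlonglongrightarrow> g x + g y"
      using tendsto_add[OF lim[OF s] lim[OF t]] F s(1) t(1) by (simp add: bounded_linear_on_def)
    ultimately show "extend_by_continuity S F (x + y)
        = extend_by_continuity S F x + extend_by_continuity S F y"
      using x y subspace_add[OF subspace_closure[OF S] x y] by (simp add: ext LIMSEQ_unique)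
  next
    fix c x assume x: "x \<in> closure S"
    obtain s where s: "\<And>n. s n \<in> S" "s \<longlonglongrightarrow> x" using x closure_sequential by metis
    have "(\<lambda>n. F (c *\<^sub>R s n)) \<longlonglongrightarrow> g (c *\<^sub>R x)"
      using s S by (intro lim tendsto_intros subspace_scale)
    moreover have "(\<lambda>n. F (c *\<^sub>R s n)) \<longlonglongrightarrow> c *\<^sub>R g x"
      using tendsto_scaleR[OF tendsto_const lim[OF s]] F s(1) by (simp add: bounded_linear_on_def)
    ultimately show "extend_by_continuity S F (c *\<^sub>R x) = c *\<^sub>R extend_by_continuity S F x"
      using x subspace_scale[OF subspace_closure[OF S] x] by (simp add: ext LIMSEQ_unique)
  next
    fix x assume x: "x \<in> closure S"
    obtain s where s: "\<And>n. s n \<in> S" "s \<longlonglongrightarrow> x" using x closure_sequential by metis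
    have "norm (g x) \<le> norm x * K"
    proof (rule LIMSEQ_le)
      show "(\<lambda>n. norm (F (s n))) \<longlonglongrightarrow> norm (g x)" by (intro tendsto_norm lim s)
      show "(\<lambda>n. norm (s n) * K) \<longlonglongrightarrow> norm x * K" by (intro tendsto_intros s)
    qed (use K s(1) in blast)
    then show "norm (extend_by_continuity S F x) \<le> norm x * K" by (simp add: ext x)
  qed
qed

section \<open>Riesz representation and the adjoint on a closed subspace\<close>

lemma riesz_representation_on:
  fixes L :: "'a::{real_inner,complete_space} \<Rightarrow> real"
  assumes L: "bounded_linear_on T L" and T: "subspace T" "closed T"
  shows "\<exists>z\<in>T. \<forall>u\<in>T. L u = inner u z"
proof -
  (* z is the minimiser of J over T: the parallelogram law makes minimising sequences Cauchy. *)
  define J where "J x = inner x x - 2 * L x" for x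
  obtain K where K: "K > 0" "\<And>x. x \<in> T \<Longrightarrow> norm (L x) \<le> norm x * K"
    using bounded_linear_onE[OF L] by metis
  have add: "L (x + y) = L x + L y" if "x \<in> T" "y \<in> T" for x y
    using L that by (auto simp: bounded_linear_on_def)
  have scale: "L (c *\<^sub>R x) = c * L x" if "x \<in> T" for c x
    using L that by (auto simp: bounded_linear_on_def)
  \<comment> \<open>Complete the square: \<open>J x\<close> is at least
    \<open>(norm x)\<^sup>2 - 2 * K * norm x\<close>, which is
    \<open>(norm x - K)\<^sup>2 - K\<^sup>2\<close>. Hence the infimum \<open>m\<close> is a genuine
    lower bound.\<close>
  have J_lower: "- K\<^sup>2 \<le> J x" if "x \<in> T" for x
  proof -
    have "0 \<le> (norm x - K)\<^sup>2" by simp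
    then have "2 * (norm x * K) \<le> inner x x + K\<^sup>2"
      by (simp add: power2_diff power2_norm_eq_inner)
    moreover have "L x \<le> norm x * K" using K(2)[OF that] by simp
    ultimately show ?thesis by (simp add: J_def)
  qed
  define m where "m = Inf (J ` T)"
  have bdd: "bdd_below (J ` T)" using J_lower by (auto intro!: bdd_belowI)
  have ne: "J ` T \<noteq> {}" using subspace_0[OF T(1)] by auto
  have m_le: "m \<le> J x" if "x \<in> T" for x
    unfolding m_def using bdd that by (simp add: cInf_lower)
  have "\<exists>x\<in>T. J x < m + 1 / real (Suc n)" for n
    using cInf_lessD[OF ne, of "m + 1 / real (Suc n)"] unfolding m_def by auto
  then obtain s where s: "\<And>n. s n \<in> T" "\<And>n. J (s n) < m + 1 / real (Suc n)"
    by metis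
  \<comment> \<open>\<open>J\<close> is the squared norm minus a linear term. The linear terms
    cancel in this combination, which leaves the ordinary parallelogram law.\<close>
  have parallelogram: "(dist x y)\<^sup>2 = 2 * J x + 2 * J y - 4 * J ((1/2) *\<^sub>R (x + y))"
    if "x \<in> T" "y \<in> T" for x y
  proof -
    define h where "h = (1/2) *\<^sub>R (x + y)"
    have "L h = (L x + L y) / 2"
      unfolding h_def using that T(1) by (simp add: scale add subspace_add del: scaleR_add_right)
    moreover have "inner h h = (inner x x + 2 * inner x y + inner y y) / 4"
      unfolding h_def inner_scaleR_left inner_scaleR_right
      by (simp add: inner_add_left inner_add_right inner_commute[of y x])
    moreover have "(dist x y)\<^sup>2 = inner x x - 2 * inner x y + inner y y"
      by (simp add: dist_norm power2_norm_eq_inner inner_diff_left inner_diff_right inner_commute[of y x])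
    ultimately show ?thesis
      unfolding J_def h_def[symmetric] by (simp add: field_simps)
  qed
  have "Cauchy s"
  proof (rule metric_CauchyI)
    fix e :: real assume e: "e > 0"
    \<comment> \<open>If two values of \<open>J\<close> are below \<open>m + e\<^sup>2 / 4\<close>
      and the midpoint value is at least \<open>m\<close>, the parallelogram identity makes the
      squared distance less than \<open>e\<^sup>2\<close>.\<close>
    obtain N where N: "1 / real (Suc N) < e\<^sup>2 / 4"
      using nat_approx_posE[of "e\<^sup>2 / 4"] e by auto
    have near: "J (s n) < m + e\<^sup>2 / 4" if "n \<ge> N" for n
    proof -
      have "1 / real (Suc n) \<le> 1 / real (Suc N)" using that by (simp add: frac_le)
      then show ?thesis using s(2)[of n] N by linarith
    qed
    have "dist (s i) (s j) < e" if "i \<ge> N" "j \<ge> N" for i j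
    proof -
      have "m \<le> J ((1/2) *\<^sub>R (s i + s j))"
        using s(1) T(1) by (intro m_le subspace_scale subspace_add)
      then have "(dist (s i) (s j))\<^sup>2 < e\<^sup>2"
        using near[OF that(1)] near[OF that(2)] parallelogram[OF s(1) s(1), of i j] by linarith
      then show ?thesis using e by (simp add: power2_less_imp_less)
    qed
    then show "\<exists>M. \<forall>i\<ge>M. \<forall>j\<ge>M. dist (s i) (s j) < e" by blast
  qed
  then obtain z where z: "s \<longlonglongrightarrow> z" by (auto simp: Cauchy_convergent_iff convergent_def)
  have zT: "z \<in> T" using closed_sequentially[OF T(2)] s(1) z by blast
  have "continuous_on T L"
    using bounded_linear_on_uniformly_continuous[OF L T(1)] by (rule uniformly_continuous_imp_continuous)
  then have "(\<lambda>n. J (s n)) \<longlonglongrightarrow> J z"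
    unfolding J_def
    by (intro tendsto_intros z continuous_on_tendsto_compose[where s = T]) (use z zT s(1) in auto)
  moreover have "(\<lambda>n. m + 1 / real (Suc n)) \<longlonglongrightarrow> m + 0"
    by (intro tendsto_intros LIMSEQ_Suc[OF lim_1_over_n])
  ultimately have "J z \<le> m + 0"
    by (rule LIMSEQ_le) (use s(2) less_imp_le in blast)
  then have Jz: "J z \<le> m" by simp
  \<comment> \<open>First variation at the minimiser: if the equation failed for some
    \<open>u\<close>, moving from \<open>z\<close> along \<open>u\<close> would push
    \<open>J\<close> below its minimum.\<close>
  have "L u = inner u z" if u: "u \<in> T" for u
  proof (rule ccontr)
    assume ne: "L u \<noteq> inner u z"
    define a where "a = L u - inner u z"
    have uu: "inner u u > 0"
    proof -
      have "u \<noteq> 0" using ne scale[OF u, of 0] by auto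
      then show ?thesis by simp
    qed
    \<comment> \<open>This \<open>t\<close> minimises the quadratic polynomial
      \<open>J (z + t *\<^sub>R u)\<close> in \<open>t\<close>; the gain over \<open>J z\<close> is
      \<open>a\<^sup>2 / inner u u\<close>.\<close>
    define t where "t = a / inner u u"
    have "J z \<le> J (z + t *\<^sub>R u)"
      using Jz m_le[of "z + t *\<^sub>R u"] zT u T(1) by (simp add: subspace_add subspace_scale)
    also have "J (z + t *\<^sub>R u) = J z + t\<^sup>2 * inner u u - 2 * t * a"
      unfolding J_def a_def using u zT T(1)
      by (simp add: scale add subspace_scale inner_add_left inner_add_right inner_commute[of z u]
          power2_eq_square algebra_simps)
    also have "\<dots> = J z - a\<^sup>2 / inner u u"
      unfolding t_def using uu by (simp add: power2_eq_square)
    finally show False using uu ne by (simp add: a_def divide_le_0_iff)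
  qed
  with zT show ?thesis by blast
qed

text \<open>For fixed \<open>y\<close>, Cauchy-Schwarz makes \<open>inner (F x) y\<close> a bounded
  functional of \<open>x\<close>, with constant \<open>K * norm y\<close>, and Riesz represents it.
  Existence and uniqueness together justify the definite description in
  \<open>adjoint_on\<close>.\<close>

lemma adjoint_on_works:
  fixes F :: "'a::{real_inner,complete_space} \<Rightarrow> 'b::real_inner"
  assumes F: "bounded_linear_on T F" and T: "subspace T" "closed T"
  shows "adjoint_on T F y \<in> T \<and> (\<forall>u\<in>T. inner (F u) y = inner u (adjoint_on T F y))"
  unfolding adjoint_on_def
proof (rule theI')
  obtain K where K: "K > 0" "\<And>x. x \<in> T \<Longrightarrow> norm (F x) \<le> norm x * K"
    using bounded_linear_onE[OF F] by metis
  have "norm (inner (F x) y) \<le> norm x * (K * norm y)" if "x \<in> T" for x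
  proof -
    have "\<bar>inner (F x) y\<bar> \<le> norm (F x) * norm y" by (rule Cauchy_Schwarz_ineq2)
    also have "\<dots> \<le> norm x * K * norm y" using K(2)[OF that] by (simp add: mult_right_mono)
    finally show ?thesis by (simp add: mult.assoc)
  qed
  then have "bounded_linear_on T (\<lambda>x. inner (F x) y)"
    using F by (auto simp: bounded_linear_on_def inner_add_left)
  then obtain z where z: "z \<in> T" "\<And>u. u \<in> T \<Longrightarrow> inner (F u) y = inner u z"
    using riesz_representation_on T by blast
  show "\<exists>!z. z \<in> T \<and> (\<forall>u\<in>T. inner (F u) y = inner u z)"
  proof (rule ex1I)
    show "z \<in> T \<and> (\<forall>u\<in>T. inner (F u) y = inner u z)" using z by blast
  next
    fix w assume w: "w \<in> T \<and> (\<forall>u\<in>T. inner (F u) y = inner u w)"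
    \<comment> \<open>Two representing vectors have the same inner product with every element of
      \<open>T\<close>; testing with their difference shows that it is orthogonal to itself.\<close>
    then have "w - z \<in> T" using z(1) T(1) by (simp add: subspace_diff)
    with w z(2) have "inner (w - z) w = inner (w - z) z" by metis
    then have "inner (w - z) (w - z) = 0" by (simp add: inner_diff_right)
    then show "w = z" by simp
  qed
qed

section \<open>Contractions and the norm of the information map\<close>

lemma onorm_on_le_1_iff:
  assumes "bounded_linear_on S F"
  shows "onorm_on S F \<le> 1 \<longleftrightarrow> (\<forall>x\<in>S. norm (F x) \<le> norm x)"
proof -
  have "ennreal (norm (F x) / norm x) \<le> 1 \<longleftrightarrow> norm (F x) \<le> norm x" if "x \<in> S" for x
  proof (cases "x = 0")
    \<comment> \<open>At zero the quotient is \<open>0\<close> by the convention for division, so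
      the right-hand side must hold as well; it does, since the bound forces
      \<open>F 0 = 0\<close>.\<close>
    case True
    obtain K where "\<And>x. x \<in> S \<Longrightarrow> norm (F x) \<le> norm x * K"
      using bounded_linear_onE[OF assms] by metis
    with that True have "norm (F x) \<le> 0" by force
    with True show ?thesis by simp
  qed (simp add: divide_le_eq_1)
  then show ?thesis by (simp add: onorm_on_def SUP_le_iff)
qed

text \<open>With \<open>w\<close> the image of \<open>x\<close>, the adjoint relation tested at
  \<open>w\<close> itself turns the squared norm of \<open>w\<close> into
  \<open>inner (F w) (F x)\<close>. Cauchy-Schwarz and contractivity at both \<open>w\<close> and
  \<open>x\<close> bound this by \<open>norm w * norm x\<close>, and one factor
  \<open>norm w\<close> cancels.\<close>

lemma onorm_on_adjoint_on_comp_le_1: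
  fixes F :: "'a::{real_inner,complete_space} \<Rightarrow> 'b::real_inner"
  assumes F: "bounded_linear_on T F" and T: "subspace T" "closed T" and le: "onorm_on T F \<le> 1"
  shows "onorm_on T (adjoint_on T F \<circ> F) \<le> 1"
proof -
  have contr: "norm (F x) \<le> norm x" if "x \<in> T" for x
    using le that by (simp add: onorm_on_le_1_iff[OF F])
  have "norm (adjoint_on T F (F x)) \<le> norm x" if x: "x \<in> T" for x
  proof -
    define w where "w = adjoint_on T F (F x)"
    have w: "w \<in> T" "inner (F w) (F x) = inner w w"
      using adjoint_on_works[OF F T, of "F x"] by (auto simp: w_def)
    have "norm w * norm w = inner (F w) (F x)"
      using w(2) by (simp add: power2_norm_eq_inner flip: power2_eq_square)
    also have "\<dots> \<le> norm (F w) * norm (F x)" by (rule norm_cauchy_schwarz)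
    also have "\<dots> \<le> norm w * norm x"
      using contr[OF w(1)] contr[OF x] by (intro mult_mono) auto
    finally have "norm w \<le> norm x"
      by (cases "w = 0") auto
    then show ?thesis by (simp add: w_def)
  qed
  \<comment> \<open>The quotients are estimated directly, because \<open>onorm_on_le_1_iff\<close>
    would first ask for the composite to be \<open>bounded_linear_on\<close>.\<close>
  then have "norm (adjoint_on T F (F x)) / norm x \<le> 1" if "x \<in> T" for x
    using that by (cases "x = 0") (auto simp: divide_le_eq_1)
  then show ?thesis by (auto simp: onorm_on_def intro!: SUP_least)
qed

section \<open>Comparison of the efficiency bounds\<close>

text \<open>Passing from \<open>p\<close> to \<open>q\<close> enlarges the kernel and shrinks the
  denominators. If \<open>d\<beta>\<close> does not vanish on the kernel of \<open>q\<close>, the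
  right-hand side is infinite; otherwise it vanishes on both kernels and both bounds are
  suprema.\<close>

lemma Bnd_antimono:
  assumes le: "\<And>\<phi>. norm (q \<phi>) \<le> norm (p \<phi>)"
  shows "Bnd d\<beta> p \<le> Bnd d\<beta> q"
proof (cases "\<forall>\<phi>. q \<phi> = 0 \<longrightarrow> d\<beta> \<phi> = 0")
  case False
  then have "Bnd d\<beta> q = \<infinity>" by (simp only: Bnd_def if_False)
  then show ?thesis by simp
next
  case q0: True
  have "q \<phi> = 0" if "p \<phi> = 0" for \<phi>
    using le[of \<phi>] that by simp
  with q0 have p0: "\<forall>\<phi>. p \<phi> = 0 \<longrightarrow> d\<beta> \<phi> = 0" by blast
  have "ennreal ((d\<beta> \<phi>)\<^sup>2 / (norm (p \<phi>))\<^sup>2)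
      \<le> (SUP \<phi>\<in>{\<phi>. q \<phi> \<noteq> 0}. ennreal ((d\<beta> \<phi>)\<^sup>2 / (norm (q \<phi>))\<^sup>2))" for \<phi>
  \<comment> \<open>The suprema run over different sets: a direction killed by \<open>q\<close> but
    not by \<open>p\<close> has no counterpart on the right. There
    \<open>d\<beta> \<phi> = 0\<close>, so its term on the left is \<open>0\<close>.\<close>
  proof (cases "q \<phi> = 0")
    case True
    then show ?thesis using q0 by simp
  next
    case False
    then have "(d\<beta> \<phi>)\<^sup>2 / (norm (p \<phi>))\<^sup>2 \<le> (d\<beta> \<phi>)\<^sup>2 / (norm (q \<phi>))\<^sup>2"
      using le[of \<phi>] by (intro divide_left_mono power_mono mult_pos_pos) auto
    with False show ?thesis by (intro SUP_upper2[of \<phi>]) (auto intro: ennreal_leI)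
  qed
  then show ?thesis
    unfolding Bnd_def if_P[OF q0] if_P[OF p0] by (rule SUP_least)
qed

lemma linear_push:
  assumes "hilbert_completion ip emb" "linear score"
  shows "linear (push ip emb score)"
proof -
  have "push ip emb score = (\<lambda>A. emb (null_coset ip A)) \<circ> score"
    by (auto simp: push_def)
  then show ?thesis
    using assms by (auto simp: hilbert_completion_def intro: linear_compose)
qed

theorem mainTheorem3:
  fixes d\<beta> :: "'t::real_vector \<Rightarrow> real"
    and ip_f :: "'v::real_vector \<Rightarrow> 'v \<Rightarrow> real"
    and emb_f :: "'v set \<Rightarrow> 'hf::{real_inner,complete_space}"
    and score :: "'t \<Rightarrow> 'v"
    and ip_g :: "'w::real_vector \<Rightarrow> 'w \<Rightarrow> real"
    and emb_g :: "'w set \<Rightarrow> 'hg::{real_inner,complete_space}"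
    and score_out :: "'t \<Rightarrow> 'w"
    and F\<^sub>0 :: "'hf \<Rightarrow> 'hg"
    and f_push :: "'t \<Rightarrow> 'hf"
    and g_push :: "'t \<Rightarrow> 'hg"
    and F_push :: "'hf \<Rightarrow> 'hg"
    and F_pull :: "'hg \<Rightarrow> 'hf"
    and Imap :: "'hf \<Rightarrow> 'hf"
  defines "f_push \<equiv> push ip_f emb_f score"
    and "g_push \<equiv> push ip_g emb_g score_out"
    and "F_push \<equiv> extend_by_continuity (range f_push) F\<^sub>0"
    and "F_pull \<equiv> adjoint_on (tangent_space f_push) F_push"
    and "Imap \<equiv> F_pull \<circ> F_push"
  assumes "linear d\<beta>"
    and "semi_inner_product ip_f"
    and "hilbert_completion ip_f emb_f"
    and "linear score"
    and "semi_inner_product ip_g"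
    and "hilbert_completion ip_g emb_g"
    and "linear score_out"
    and "bounded_linear_on (range f_push) F\<^sub>0"
    and "g_push = F\<^sub>0 \<circ> f_push"
    and "onorm_on (tangent_space f_push) F_push \<le> 1"
  shows "Bnd d\<beta> g_push \<ge> Bnd d\<beta> f_push \<and> onorm_on (tangent_space f_push) Imap \<le> 1"
proof
  have S: "subspace (range f_push)"
    unfolding f_push_def using linear_push[OF assms(8,9)]
    by (simp add: linear_subspace_image subspace_UNIV)
  then have T: "subspace (tangent_space f_push)" "closed (tangent_space f_push)"
    by (simp_all add: tangent_space_def subspace_closure)
  have F: "bounded_linear_on (tangent_space f_push) F_push"
    unfolding tangent_space_def F_push_def
    using assms(13) S by (rule bounded_linear_on_extend_by_continuity)
  \<comment> \<open>Monotonicity, stated for the extended map on the whole tangent space, is applied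
    at the vectors \<open>f_push \<phi>\<close>. On the range the extension is
    \<open>F\<^sub>0\<close> itself, which sends them to \<open>g_push \<phi>\<close>.\<close>
  have "norm (g_push \<phi>) \<le> norm (f_push \<phi>)" for \<phi>
  proof -
    have "f_push \<phi> \<in> tangent_space f_push"
      unfolding tangent_space_def by (rule subsetD[OF closure_subset rangeI])
    then have "norm (F_push (f_push \<phi>)) \<le> norm (f_push \<phi>)"
      using assms(15) by (simp add: onorm_on_le_1_iff[OF F])
    then show ?thesis by (simp add: assms(14) F_push_def extend_by_continuity_def)
  qed
  then show "Bnd d\<beta> f_push \<le> Bnd d\<beta> g_push" by (rule Bnd_antimono)
  show "onorm_on (tangent_space f_push) Imap \<le> 1"
    unfolding Imap_def F_pull_def using F T assms(15) by (rule onorm_on_adjoint_on_comp_le_1)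
qed

end
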